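(* Let $\Omega^+\subseteq\mathbb{R}^2$ be a Jordan domain, let $\Omega^-:=\mathbb{R}^2\setminus\overline{\Omega^+}$, and let $\Gamma:=\partial\Omega^{\pm}$. Fix $\alpha\in(0,1)$ and $C_0>0$. Suppose there exists $r_0>0$ such that $$\varepsilon(x,r)\le C_0 r^{\alpha}\qquad\text{for all } x\in\Gamma,\ r\le r_0 .$$ Then there exist $0<\rho_0\le r_0$ and a constant $C>0$ (independent of $x_0$ and $r$ below) so that for every $x_0\in\Gamma$ and every $0<r\le\rho_0$ there exists a line $L_0$ through $x_0$ such that $$\sup_{x\in L_0\cap B(x_0,r)} d\big(x,\Gamma\cap B(x_0,r)\big)< C r^{\alpha/2+1}.$$
   Context: A Jordan domain is a domain in $\mathbb{R}^2$ whose boundary is a Jordan curve. For $x\in\Gamma$ and $r>0$, $I^{\pm}(x,r)$ denotes the largest (with respect to $\mathcal{H}^1$-measure) open arc of the circumference $\partial B(x,r)$ contained in $\Omega^{\pm}$. The Carleson $\varepsilon$-function is $$\varepsilon(x,r)=\frac1r\max\left\{|\pi r-\mathcal{H}^1(I^+(x,r))|,\ |\pi r-\mathcal{H}^1(I^-(x,r))|\right\}.$$ *)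

theory Defs
  imports "HOL-Analysis.Analysis"
begin

definition jordan_curve :: "(real ^ 2) set \<Rightarrow> bool" where
  "jordan_curve J \<longleftrightarrow>
     (\<exists>g. simple_path g \<and> pathfinish g = pathstart g \<and> path_image g = J)"

definition jordan_domain :: "(real ^ 2) set \<Rightarrow> bool" where
  "jordan_domain D \<longleftrightarrow> open D \<and> connected D \<and> D \<noteq> {} \<and> jordan_curve (frontier D)"

(* One-dimensional Hausdorff measure, with the normalisation under which it agrees with
   length.  The covering sets are required to be bounded because diameter carries no
   information on unbounded sets. *)

definition hausdorff_pre :: "real \<Rightarrow> 'a::metric_space set \<Rightarrow> ennreal" where
  "hausdorff_pre \<delta> A =
     (INF E \<in> {E :: nat \<Rightarrow> 'a set.
                 A \<subseteq> (\<Union>i. E i) \<and> (\<forall>i. bounded (E i) \<and> diameter (E i) \<le> \<delta>)}.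
        \<Sum>i. ennreal (diameter (E i)))"

definition hausdorff1 :: "'a::metric_space set \<Rightarrow> ennreal" where
  "hausdorff1 A = (SUP \<delta> \<in> {0<..}. hausdorff_pre \<delta> A)"

(* The case a = b makes the empty set an arc, so that the largest arc below has measure 0
   when the circle does not meet D in any nondegenerate arc.  The case b = a + 2 * pi is
   the circle with one point removed, which has the same measure as the whole circle. *)

definition open_arc :: "real ^ 2 \<Rightarrow> real \<Rightarrow> (real ^ 2) set \<Rightarrow> bool" where
  "open_arc x r I \<longleftrightarrow>
     (\<exists>a b. a \<le> b \<and> b \<le> a + 2 * pi \<and>
        I = (\<lambda>t. x + r *\<^sub>R vector [cos t, sin t]) ` {a<..<b})"

(* A largest arc need not be unique, but all largest arcs have the same measure. *)

definition largest_arc :: "(real ^ 2) set \<Rightarrow> real ^ 2 \<Rightarrow> real \<Rightarrow> (real ^ 2) set" where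
  "largest_arc D x r =
     (SOME I. open_arc x r I \<and> I \<subseteq> D \<and>
        (\<forall>J. open_arc x r J \<and> J \<subseteq> D \<longrightarrow> hausdorff1 J \<le> hausdorff1 I))"

definition carleson_eps ::
    "(real ^ 2) set \<Rightarrow> (real ^ 2) set \<Rightarrow> real ^ 2 \<Rightarrow> real \<Rightarrow> real" where
  "carleson_eps Dp Dm x r =
     1 / r * max \<bar>pi * r - enn2real (hausdorff1 (largest_arc Dp x r))\<bar>
                 \<bar>pi * r - enn2real (hausdorff1 (largest_arc Dm x r))\<bar>"

definition line_through :: "real ^ 2 \<Rightarrow> (real ^ 2) set \<Rightarrow> bool" where
  "line_through x L \<longleftrightarrow> affine L \<and> aff_dim L = 1 \<and> x \<in> L"

end

theory Submission
  imports Defs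
begin

text \<open>
  The idea is to walk along the boundary \<open>\<Gamma>\<close> in steps of one fixed length \<open>t\<close> that is much
  smaller than \<open>r\<close>.  Let \<open>x, y \<in> \<Gamma>\<close> with \<open>|x - y| = t\<close>.  The circle of radius \<open>t\<close> about \<open>x\<close>
  carries two disjoint arcs, one in \<open>\<Omega>p\<close> and one in \<open>\<Omega>m\<close>, each of angle at least
  \<open>\<pi> - C0 t\<^sup>\<alpha>\<close>, and neither contains \<open>y\<close>.  Cutting the circle open at \<open>y\<close>, the gap between the
  two arcs lies within angle \<open>C0 t\<^sup>\<alpha>\<close> of the antipode \<open>2x - y\<close> of \<open>y\<close>, and by connectedness this
  gap contains a point \<open>z\<close> of \<open>\<Gamma>\<close> (lemma \<open>antipode_near_frontier\<close>).  Thus \<open>|x - z| = t\<close> again,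
  and \<open>z\<close> misses \<open>2x - y\<close> by at most \<open>E = t \<cdot> C0 t\<^sup>\<alpha>\<close>.

  The step can therefore be repeated with the same \<open>t\<close>, which gives points
  \<open>p\<^sub>0 = x0, p\<^sub>1, p\<^sub>2, \<dots>\<close> of \<open>\<Gamma>\<close> whose second differences are bounded by \<open>E\<close>.  Hence \<open>p\<^sub>k\<close>
  differs from \<open>x0 + k (p\<^sub>1 - x0)\<close> by at most \<open>k\<^sup>2 E\<close> (lemma \<open>almost_straight_chain\<close>).  A second
  chain started at the near antipode of \<open>p\<^sub>1\<close> covers the opposite direction.  As long as
  \<open>k t < r\<close> the points stay in the ball of radius \<open>r\<close>, so each point of the line through \<open>x0\<close> and
  \<open>p\<^sub>1\<close> inside that ball is within \<open>t + 2 (r/t)\<^sup>2 E\<close> of \<open>\<Gamma>\<close> in the ball (lemma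
  \<open>line_near_chain\<close>).  With \<open>t\<close> equal to \<open>r\<close> to the power \<open>1 + \<alpha>/2\<close> the factor \<open>(r/t)\<^sup>2 t\<^sup>\<alpha>\<close> is
  \<open>r\<close> to the power \<open>\<alpha>\<^sup>2/2\<close>, at most 1 for \<open>r \<le> 1\<close>, and the bound becomes \<open>(1 + 2 C0) t\<close>.

  To read angles off the Hausdorff measure of the largest arc, one needs that a largest arc exists
  (compactness of the set of pairs of end points) and that an arc of angle \<open>\<beta>\<close> has measure at most
  \<open>r \<beta>\<close>: a lower bound for the measure is then a lower bound for the angle.
\<close>

section \<open>Hausdorff measure of reparametrised sets\<close>

text \<open>
  Pulling a covering of \<open>h ` T\<close> back to \<open>T\<close> and pushing it forward along \<open>g\<close> multiplies diameters by
  at most \<open>L\<close>.  Stating this for two parametrisations of sets, instead of a Lipschitz map from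
  \<open>h ` T\<close> to \<open>g ` T\<close>, makes rotations of a circle available without writing down a map of the plane.
\<close>

lemma hausdorff1_image_le:
  fixes g :: "'i \<Rightarrow> 'a::metric_space" and h :: "'i \<Rightarrow> 'b::metric_space"
  assumes L: "0 < L"
    and le: "\<And>s t. s \<in> T \<Longrightarrow> t \<in> T \<Longrightarrow> dist (g s) (g t) \<le> L * dist (h s) (h t)"
  shows "hausdorff1 (g ` T) \<le> ennreal L * hausdorff1 (h ` T)"
proof -
  have pre: "hausdorff_pre \<delta> (g ` T) \<le> ennreal L * hausdorff1 (h ` T)" if "\<delta> > 0" for \<delta>
  proof -
    have sum_le: "hausdorff_pre \<delta> (g ` T) / ennreal L \<le> (\<Sum>i. ennreal (diameter (E i)))"
      if cov: "h ` T \<subseteq> (\<Union>i. E i)" and E: "\<And>i. bounded (E i) \<and> diameter (E i) \<le> \<delta> / L"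
      for E :: "nat \<Rightarrow> 'b set"
    proof -
      define F where "F i = g ` {t \<in> T. h t \<in> E i}" for i
      have dF: "dist p q \<le> L * diameter (E i)" if pq: "p \<in> F i" "q \<in> F i" for i p q
      proof -
        obtain s t where st: "s \<in> T" "h s \<in> E i" "t \<in> T" "h t \<in> E i" "p = g s" "q = g t"
          using pq by (auto simp: F_def)
        have "dist p q \<le> L * dist (h s) (h t)"
          using st le by auto
        also have "\<dots> \<le> L * diameter (E i)"
          using diameter_bounded_bound E st L by (intro mult_left_mono) auto
        finally show ?thesis .
      qed
      have bF: "bounded (F i)" for i
        unfolding bounded_two_points using dF by blast
      have diamF: "diameter (F i) \<le> L * diameter (E i)" for i
      proof (cases "F i = {}")
        case True
        then show ?thesis
          using L E[of i] by (simp add: diameter_ge_0)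
      next
        case False
        then show ?thesis
          unfolding diameter_def[of "F i"] using dF by (auto intro!: cSUP_least)
      qed
      have "diameter (F i) \<le> \<delta>" for i
      proof -
        have "diameter (F i) \<le> L * (\<delta> / L)"
          using diamF[of i] E[of i] L mult_left_mono[of "diameter (E i)" "\<delta> / L" L] by linarith
        then show ?thesis using L by simp
      qed
      moreover have "g ` T \<subseteq> (\<Union>i. F i)"
        using cov by (fastforce simp: F_def)
      ultimately have "hausdorff_pre \<delta> (g ` T) \<le> (\<Sum>i. ennreal (diameter (F i)))"
        unfolding hausdorff_pre_def using bF by (intro INF_lower) auto
      also have "\<dots> \<le> (\<Sum>i. ennreal L * ennreal (diameter (E i)))"
        using diamF L by (intro suminf_le) (auto simp flip: ennreal_mult' intro!: ennreal_leI)
      also have "\<dots> = (\<Sum>i. ennreal (diameter (E i))) * ennreal L"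
        by (simp add: mult.commute)
      finally show ?thesis
        using L by (subst divide_le_posI_ennreal) (auto simp: mult.commute)
    qed
    have "hausdorff_pre \<delta> (g ` T) / ennreal L \<le> hausdorff_pre (\<delta> / L) (h ` T)"
      unfolding hausdorff_pre_def[of "\<delta> / L"] using sum_le by (intro INF_greatest) auto
    also have "\<dots> \<le> hausdorff1 (h ` T)"
      unfolding hausdorff1_def using that L by (intro SUP_upper) auto
    finally have "ennreal L * (hausdorff_pre \<delta> (g ` T) / ennreal L) \<le> ennreal L * hausdorff1 (h ` T)"
      by (rule mult_left_mono) simp
    moreover have "ennreal L * (hausdorff_pre \<delta> (g ` T) / ennreal L) = hausdorff_pre \<delta> (g ` T)"
      using L ennreal_mult_divide_eq[of "ennreal L" "hausdorff_pre \<delta> (g ` T)"]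
      by (simp add: ennreal_times_divide mult.commute[of "ennreal L"])
    ultimately show ?thesis by simp
  qed
  then show ?thesis
    unfolding hausdorff1_def[of "g ` T"] by (intro SUP_least) auto
qed

lemma hausdorff1_mono: "A \<subseteq> B \<Longrightarrow> hausdorff1 A \<le> hausdorff1 B"
  unfolding hausdorff1_def hausdorff_pre_def
  by (intro SUP_mono bexI[of _ "_::real"] INF_superset_mono) auto

lemma hausdorff1_interval_le:
  fixes a b :: real
  assumes "a \<le> b"
  shows "hausdorff1 {a<..<b} \<le> ennreal (b - a)"
  unfolding hausdorff1_def
proof (rule SUP_least)
  fix \<delta> :: real assume "\<delta> \<in> {0<..}"
  then have \<delta>: "\<delta> > 0" by simp
  obtain n :: nat where n: "(b - a) / \<delta> < n" using reals_Archimedean2 by blast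
  moreover have "0 \<le> (b - a) / \<delta>" using assms \<delta> by simp
  ultimately have n0: "0 < real n" by linarith
  define h where "h = (b - a) / n"
  have h0: "0 \<le> h" and h\<delta>: "h \<le> \<delta>" and nh: "n * h = b - a"
    using assms n n0 \<delta> by (auto simp: h_def field_simps)
  define E where "E i = (if i < n then {a + i * h..a + (i + 1) * h} else {})" for i :: nat
  have diamE: "diameter (E i) = (if i < n then h else 0)" for i
    using h0 by (auto simp: E_def algebra_simps diameter_closed_interval)
  have cov: "{a<..<b} \<subseteq> (\<Union>i. E i)"
  proof
    fix x assume x: "x \<in> {a<..<b}"
    then have h_pos: "0 < h" using n0 by (auto simp: h_def)
    define i where "i = nat \<lfloor>(x - a) / h\<rfloor>"
    have "0 \<le> (x - a) / h" using x h_pos by auto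
    then have i: "real i \<le> (x - a) / h" "(x - a) / h < real i + 1"
      unfolding i_def by linarith+
    have "(x - a) / h < n" using x nh h_pos by (simp add: divide_less_eq)
    then have "i < n" using i by linarith
    moreover have "x \<in> {a + i * h..a + (i + 1) * h}"
      using i h_pos by (auto simp: field_simps)
    ultimately show "x \<in> (\<Union>i. E i)" by (auto simp: E_def)
  qed
  have "hausdorff_pre \<delta> {a<..<b} \<le> (\<Sum>i. ennreal (diameter (E i)))"
    unfolding hausdorff_pre_def
  proof (intro INF_lower CollectI conjI allI cov)
    show "bounded (E i)" for i by (simp add: E_def)
    show "diameter (E i) \<le> \<delta>" for i using diamE h\<delta> \<delta> by simp
  qed
  also have "\<dots> = (\<Sum>i<n. ennreal (diameter (E i)))"
    by (rule suminf_finite) (auto simp: diamE)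
  also have "\<dots> = ennreal (b - a)"
    using h0 nh by (simp add: diamE ennreal_of_nat_eq_real_of_nat flip: ennreal_mult')
  finally show "hausdorff_pre \<delta> {a<..<b} \<le> ennreal (b - a)" .
qed

section \<open>Circles and their arcs\<close>

definition circle_point :: "real ^ 2 \<Rightarrow> real \<Rightarrow> real \<Rightarrow> real ^ 2" where
  "circle_point x r t = x + r *\<^sub>R vector [cos t, sin t]"

lemma open_arc_iff:
  "open_arc x r I \<longleftrightarrow> (\<exists>a b. a \<le> b \<and> b \<le> a + 2 * pi \<and> I = circle_point x r ` {a<..<b})"
  by (simp add: open_arc_def circle_point_def)

lemma continuous_on_circle_point [continuous_intros]: "continuous_on S (circle_point x r)"
proof -
  have "circle_point x r = (\<lambda>t. x + r *\<^sub>R (cos t *\<^sub>R axis 1 1 + sin t *\<^sub>R axis 2 1))"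
    by (auto simp: circle_point_def fun_eq_iff vec_eq_iff forall_2 axis_def)
  moreover have "continuous_on S (\<lambda>t. x + r *\<^sub>R (cos t *\<^sub>R axis 1 1 + sin t *\<^sub>R axis 2 1))"
    by (intro continuous_intros)
  ultimately show ?thesis by metis
qed

text \<open>
  The chord depends on \<open>s - t\<close> only; this is the rotation invariance used to compare arcs.
\<close>

lemma dist_circle_point:
  assumes "0 \<le> r"
  shows "dist (circle_point x r s) (circle_point x r t) = 2 * r * \<bar>sin ((s - t) / 2)\<bar>"
proof -
  have "(cos s - cos t)\<^sup>2 + (sin s - sin t)\<^sup>2 = 2 - 2 * cos (s - t)"
    using sin_cos_squared_add[of s] sin_cos_squared_add[of t]
    by (simp add: cos_diff power2_eq_square algebra_simps)
  also have "cos (s - t) = 1 - 2 * (sin ((s - t) / 2))\<^sup>2"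
    using cos_double_sin[of "(s - t) / 2"]
    by (simp del: diff_divide_distrib right_diff_distrib_numeral)
  also have "2 - 2 * (1 - 2 * (sin ((s - t) / 2))\<^sup>2) = (2 * sin ((s - t) / 2))\<^sup>2"
    by (simp add: power_mult_distrib)
  finally have *: "(cos s - cos t)\<^sup>2 + (sin s - sin t)\<^sup>2 = (2 * sin ((s - t) / 2))\<^sup>2" .
  have "dist (circle_point x r s) (circle_point x r t)
      = norm (r *\<^sub>R (vector [cos s, sin s] - vector [cos t, sin t] :: real ^ 2))"
    by (simp add: dist_norm circle_point_def scaleR_diff_right)
  also have "\<dots> = r * sqrt ((cos s - cos t)\<^sup>2 + (sin s - sin t)\<^sup>2)"
    using assms by (simp add: norm_vec_def L2_set_def UNIV_2 power_mult_distrib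
        real_sqrt_mult flip: distrib_left)
  finally show ?thesis
    unfolding * by (simp add: real_sqrt_mult)
qed

lemma dist_circle_point_le:
  assumes "0 \<le> r"
  shows "dist (circle_point x r s) (circle_point x r t) \<le> r * \<bar>s - t\<bar>"
  unfolding dist_circle_point[OF assms]
  using mult_left_mono[OF abs_sin_x_le_abs_x[of "(s - t) / 2"], of "2 * r"] assms by simp

lemma dist_center_circle_point: "0 \<le> r \<Longrightarrow> dist x (circle_point x r t) = r"
  by (simp add: circle_point_def dist_norm norm_vec_def L2_set_def UNIV_2 power_mult_distrib
      flip: distrib_left)

lemma circle_point_surj:
  assumes "dist x y = r"
  obtains t where "y = circle_point x r t"
proof (cases "r = 0")
  case True
  then show ?thesis using assms that[of 0] by (simp add: circle_point_def)
next
  case False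
  have "((y - x) $ 1)\<^sup>2 + ((y - x) $ 2)\<^sup>2 = r\<^sup>2"
    using assms
    by (auto simp: dist_norm norm_vec_def L2_set_def UNIV_2 power2_commute)
  then have "((y - x) $ 1 / r)\<^sup>2 + ((y - x) $ 2 / r)\<^sup>2 = 1"
    using False by (simp add: power_divide flip: add_divide_distrib)
  then obtain t where "(y - x) $ 1 / r = cos t" "(y - x) $ 2 / r = sin t"
    using sincos_total_2pi by metis
  then have "y = circle_point x r t"
    using False by (auto simp: circle_point_def vec_eq_iff forall_2 field_simps)
  then show ?thesis by (rule that)
qed

lemma circle_point_antipode: "circle_point x r (t + pi) = 2 *\<^sub>R x - circle_point x r t"
  by (simp add: circle_point_def vec_eq_iff forall_2)

lemma circle_point_periodic: "circle_point x r (t + 2 * pi * of_int k) = circle_point x r t"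
  by (simp add: circle_point_def cos_add sin_add)

text \<open>
  Angles are determined up to multiples of \<open>2\<pi>\<close>, so the first end point of an arc can be moved into
  any prescribed period.
\<close>

lemma open_arc_start_in:
  assumes "open_arc x r I"
  obtains a b where "\<theta> \<le> a" "a < \<theta> + 2 * pi" "a \<le> b" "b \<le> a + 2 * pi"
    "I = circle_point x r ` {a<..<b}"
proof -
  obtain a b where ab: "a \<le> b" "b \<le> a + 2 * pi" "I = circle_point x r ` {a<..<b}"
    using assms unfolding open_arc_iff by blast
  \<comment> \<open>the number of full turns that bring \<open>a\<close> into the period starting at \<open>\<theta>\<close>\<close>
  define k where "k = - \<lfloor>(a - \<theta>) / (2 * pi)\<rfloor>"
  define s where "s = 2 * pi * of_int k"
  have "of_int (-k) \<le> (a - \<theta>) / (2 * pi)" "(a - \<theta>) / (2 * pi) < of_int (-k) + 1"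
    unfolding k_def by linarith+
  then have "\<theta> \<le> a + s" "a + s < \<theta> + 2 * pi"
    by (auto simp: s_def field_simps)
  moreover have "circle_point x r ` {a + s<..<b + s} = I"
  proof -
    have "{a + s<..<b + s} = (\<lambda>t. t + s) ` {a<..<b}"
      by (auto intro!: image_eqI[of _ _ "u - s" for u])
    then show ?thesis
      by (simp only: ab(3) image_image s_def circle_point_periodic)
  qed
  ultimately show ?thesis
    using ab(1,2) that[of "a + s" "b + s"] by simp
qed

lemma hausdorff1_arc_mono:
  assumes "0 \<le> r" "b' - a' \<le> b - a"
  shows "hausdorff1 (circle_point x r ` {a'<..<b'}) \<le> hausdorff1 (circle_point x r ` {a<..<b})"
proof -
  have "hausdorff1 (circle_point x r ` {a'<..<b'})
      \<le> ennreal 1 * hausdorff1 ((\<lambda>t. circle_point x r (t + (a - a'))) ` {a'<..<b'})"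
    using assms by (intro hausdorff1_image_le) (auto simp: dist_circle_point)
  also have "\<dots> \<le> hausdorff1 (circle_point x r ` {a<..<b})"
    using assms by (auto intro!: hausdorff1_mono imageI)
  finally show ?thesis .
qed

lemma hausdorff1_arc_le:
  assumes "0 < r" "a \<le> b"
  shows "hausdorff1 (circle_point x r ` {a<..<b}) \<le> ennreal (r * (b - a))"
proof -
  have "hausdorff1 (circle_point x r ` {a<..<b}) \<le> ennreal r * hausdorff1 ((\<lambda>t. t) ` {a<..<b})"
    using assms dist_circle_point_le[of r]
    by (intro hausdorff1_image_le) (auto simp: dist_real_def)
  also have "\<dots> \<le> ennreal r * ennreal (b - a)"
    using hausdorff1_interval_le[OF assms(2)] by (intro mult_left_mono) auto
  finally show ?thesis
    using assms by (simp add: ennreal_mult)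
qed

text \<open>
  An arc is contained in \<open>D\<close> iff every angle whose point lies outside \<open>D\<close> is at most the first or at
  least the second end point.  These conditions are closed in the pair of end points.
  So the arcs in \<open>D\<close> that start in one period have a compact set of end point pairs, on which the
  angle attains its maximum.  An arc of maximal angle has maximal measure, because any other one can
  be rotated into it.  Hence the choice in the definition of the largest arc is justified.
\<close>

lemma largest_arc_is_arc:
  assumes "0 < r"
  shows "open_arc x r (largest_arc D x r) \<and> largest_arc D x r \<subseteq> D"
proof -
  define S where "S = {p :: real \<times> real. fst p \<in> {0..2 * pi} \<and> snd p \<in> {0..4 * pi} \<and> fst p \<le> snd p \<and>
    snd p \<le> fst p + 2 * pi \<and> circle_point x r ` {fst p<..<snd p} \<subseteq> D}"
  have "S = ({0..2 * pi} \<times> {0..4 * pi}) \<inter> {p. fst p \<le> snd p} \<inter> {p. snd p \<le> fst p + 2 * pi} \<inter>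
      (\<Inter>t \<in> {t. circle_point x r t \<notin> D}. {p. t \<le> fst p} \<union> {p. snd p \<le> t})"
    by (auto simp: S_def image_subset_iff not_less) (meson not_less)+
  moreover have "compact \<dots>"
    by (intro compact_Int_closed compact_Times compact_Icc closed_INT ballI closed_Un
        closed_Collect_le continuous_intros)
  ultimately have "compact S" by simp
  moreover have "(0, 0) \<in> S" by (simp add: S_def)
  ultimately obtain p where p: "p \<in> S" and max: "\<And>q. q \<in> S \<Longrightarrow> snd q - fst q \<le> snd p - fst p"
    using continuous_attains_sup[of S "\<lambda>q. snd q - fst q"] by (force intro: continuous_intros)
  define I where "I = circle_point x r ` {fst p<..<snd p}"
  have I: "open_arc x r I \<and> I \<subseteq> D"
    using p unfolding open_arc_iff S_def I_def by auto
  moreover have "hausdorff1 J \<le> hausdorff1 I" if J: "open_arc x r J" "J \<subseteq> D" for J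
  proof -
    obtain a b where ab: "0 \<le> a" "a < 0 + 2 * pi" "a \<le> b" "b \<le> a + 2 * pi"
        "J = circle_point x r ` {a<..<b}"
      using open_arc_start_in[OF J(1)] by metis
    then have "(a, b) \<in> S" using J by (auto simp: S_def)
    then show ?thesis
      unfolding I_def ab(5) using max[of "(a, b)"] assms by (intro hausdorff1_arc_mono) auto
  qed
  ultimately show ?thesis
    unfolding largest_arc_def by (smt (verit, ccfv_threshold) someI_ex)
qed

lemma largest_arc_length:
  assumes "0 < r" and eps: "\<bar>pi * r - enn2real (hausdorff1 (largest_arc D x r))\<bar> \<le> r * \<epsilon>"
  obtains a b where "\<theta> \<le> a" "a < \<theta> + 2 * pi" "pi - \<epsilon> \<le> b - a"
    "circle_point x r ` {a<..<b} \<subseteq> D"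
proof -
  obtain a b where ab: "\<theta> \<le> a" "a < \<theta> + 2 * pi" "a \<le> b" "b \<le> a + 2 * pi"
      "largest_arc D x r = circle_point x r ` {a<..<b}"
    using open_arc_start_in largest_arc_is_arc[OF assms(1)] by metis
  then have sub: "circle_point x r ` {a<..<b} \<subseteq> D"
    using largest_arc_is_arc[OF assms(1)] by metis
  have "enn2real (hausdorff1 (largest_arc D x r)) \<le> r * (b - a)"
    unfolding ab(5) using hausdorff1_arc_le[OF assms(1) ab(3)] assms(1) ab(3)
    by (intro enn2real_leI) auto
  then have "r * (pi - \<epsilon>) \<le> r * (b - a)"
    using eps by (simp add: algebra_simps)
  then show ?thesis using assms(1) ab sub by (intro that) auto
qed

text \<open>
  If the point at angle \<open>\<theta>\<close> is outside \<open>D\<close>, the circle can be cut open there: an arc in \<open>D\<close> that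
  starts in the period \<open>[\<theta>, \<theta> + 2\<pi>)\<close> cannot run past its end.
\<close>

lemma largest_arc_avoiding_point:
  assumes "0 < r" and eps: "\<bar>pi * r - enn2real (hausdorff1 (largest_arc D x r))\<bar> \<le> r * \<epsilon>"
    and "\<epsilon> < pi" and y: "circle_point x r \<theta> \<notin> D"
  obtains a b where "\<theta> \<le> a" "a < b" "b \<le> \<theta> + 2 * pi" "pi - \<epsilon> \<le> b - a"
    "circle_point x r ` {a<..<b} \<subseteq> D"
proof -
  obtain a b where ab: "\<theta> \<le> a" "a < \<theta> + 2 * pi" "pi - \<epsilon> \<le> b - a"
      "circle_point x r ` {a<..<b} \<subseteq> D"
    using largest_arc_length[OF assms(1,2)] by metis
  have "b \<le> \<theta> + 2 * pi"
  proof (rule ccontr)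
    assume "\<not> ?thesis"
    then have "circle_point x r (\<theta> + 2 * pi) \<in> D"
      using ab by auto
    then show False using y circle_point_periodic[of x r \<theta> 1] by simp
  qed
  then show ?thesis
    using ab \<open>\<epsilon> < pi\<close> by (intro that) auto
qed

section \<open>Nearly antipodal boundary points\<close>

lemma carleson_eps_leD:
  assumes "0 < r" "carleson_eps A B x r \<le> \<epsilon>"
  shows "\<bar>pi * r - enn2real (hausdorff1 (largest_arc A x r))\<bar> \<le> r * \<epsilon>"
    and "\<bar>pi * r - enn2real (hausdorff1 (largest_arc B x r))\<bar> \<le> r * \<epsilon>"
proof -
  have "max \<bar>pi * r - enn2real (hausdorff1 (largest_arc A x r))\<bar>
      \<bar>pi * r - enn2real (hausdorff1 (largest_arc B x r))\<bar> \<le> r * \<epsilon>"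
    using assms unfolding carleson_eps_def by (simp add: field_simps)
  then show "\<bar>pi * r - enn2real (hausdorff1 (largest_arc A x r))\<bar> \<le> r * \<epsilon>"
    and "\<bar>pi * r - enn2real (hausdorff1 (largest_arc B x r))\<bar> \<le> r * \<epsilon>"
    by auto
qed

text \<open>
  The circle segment from the middle of the first arc to the middle of the second one is connected and
  leaves \<open>A\<close>, so it meets the frontier; it can do so only in the gap, as the arcs avoid the frontier.
\<close>

lemma frontier_between_arcs:
  assumes "circle_point x r ` {a<..<b} \<subseteq> A" "circle_point x r ` {c<..<d} \<subseteq> B"
    and "a < b" "b \<le> c" "c < d"
    and "A \<inter> B = {}" "A \<inter> frontier A = {}" "B \<inter> frontier A = {}"
  obtains \<phi> where "b \<le> \<phi>" "\<phi> \<le> c" "circle_point x r \<phi> \<in> frontier A"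
proof -
  define s where "s = (a + b) / 2"
  define t where "t = (c + d) / 2"
  have st: "a < s" "s < b" "c < t" "t < d" using assms by (auto simp: s_def t_def)
  have conn: "connected (circle_point x r ` {s..t})"
    by (intro connected_continuous_image continuous_intros connected_Icc)
  have "circle_point x r s \<in> A" "circle_point x r t \<in> B"
    using st assms(1,2) by (simp_all add: image_subset_iff)
  then have "circle_point x r s \<in> A" "circle_point x r t \<notin> A"
    using \<open>A \<inter> B = {}\<close> by blast+
  moreover have "s \<in> {s..t}" "t \<in> {s..t}"
    using st \<open>b \<le> c\<close> by auto
  ultimately have "circle_point x r ` {s..t} \<inter> A \<noteq> {}" "circle_point x r ` {s..t} - A \<noteq> {}"
    by blast+
  from connected_Int_frontier[OF conn this]
  obtain \<phi> where \<phi>: "s \<le> \<phi>" "\<phi> \<le> t" "circle_point x r \<phi> \<in> frontier A"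
    by auto
  then have "circle_point x r \<phi> \<notin> A" "circle_point x r \<phi> \<notin> B"
    using assms(7,8) by blast+
  then have "\<not> \<phi> < b" "\<not> c < \<phi>"
    using \<phi>(1,2) st assms(1,2) unfolding image_subset_iff by fastforce+
  then show ?thesis using that[of \<phi>] \<phi>(3) by simp
qed

text \<open>
  Cut the circle open at \<open>y\<close>, at angle \<open>\<theta>\<close>.  Two disjoint intervals of length at least \<open>\<pi> - \<epsilon>\<close> in
  \<open>[\<theta>, \<theta> + 2\<pi>]\<close> leave between them a gap inside \<open>[\<theta> + \<pi> - \<epsilon>, \<theta> + \<pi> + \<epsilon>]\<close>, in either order.  The
  frontier point in this gap is the required one.
\<close>

lemma antipode_near_frontier:
  assumes A: "open A" and B: "B = UNIV - closure A"
    and r: "0 < r" and \<epsilon>: "\<epsilon> < pi"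
    and eps: "carleson_eps A B x r \<le> \<epsilon>"
    and y: "y \<in> frontier A" "dist x y = r"
  obtains z where "z \<in> frontier A" "dist x z = r" "dist z (2 *\<^sub>R x - y) \<le> r * \<epsilon>"
proof -
  have disj: "A \<inter> B = {}" "A \<inter> frontier A = {}" "B \<inter> frontier A = {}" "B \<inter> A = {}"
    using A B closure_subset[of A] by (auto simp: frontier_def interior_open)
  obtain \<theta> where \<theta>: "y = circle_point x r \<theta>"
    using circle_point_surj y(2) by metis
  have nin: "circle_point x r \<theta> \<notin> A" "circle_point x r \<theta> \<notin> B"
    using y \<theta> disj by auto
  note e = carleson_eps_leD[OF r eps]
  obtain a b where ab: "\<theta> \<le> a" "a < b" "b \<le> \<theta> + 2 * pi" "pi - \<epsilon> \<le> b - a"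
      "circle_point x r ` {a<..<b} \<subseteq> A"
    using largest_arc_avoiding_point[OF r e(1) \<epsilon> nin(1)] by metis
  obtain c d where cd: "\<theta> \<le> c" "c < d" "d \<le> \<theta> + 2 * pi" "pi - \<epsilon> \<le> d - c"
      "circle_point x r ` {c<..<d} \<subseteq> B"
    using largest_arc_avoiding_point[OF r e(2) \<epsilon> nin(2)] by metis
  have "{a<..<b} \<inter> {c<..<d} = {}"
  proof (rule equals0I)
    fix s assume "s \<in> {a<..<b} \<inter> {c<..<d}"
    then have "circle_point x r s \<in> A \<inter> B"
      using ab(5) cd(5) unfolding image_subset_iff by simp
    then show False using disj(1) by simp
  qed
  then have "{max a c<..<min b d} = {}" by simp
  then have sep: "b \<le> c \<or> d \<le> a"
    using ab(2) cd(2) by auto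
  have frB: "frontier B \<subseteq> frontier A"
    unfolding B Compl_eq_Diff_UNIV[symmetric] frontier_complement
    by (auto simp: frontier_def dest: interior_mono[OF closure_subset, THEN subsetD])
  have "\<exists>\<phi>. \<theta> + pi - \<epsilon> \<le> \<phi> \<and> \<phi> \<le> \<theta> + pi + \<epsilon> \<and> circle_point x r \<phi> \<in> frontier A"
  proof (cases "b \<le> c")
    case True
    then obtain \<phi> where "b \<le> \<phi>" "\<phi> \<le> c" "circle_point x r \<phi> \<in> frontier A"
      using frontier_between_arcs[OF ab(5) cd(5) ab(2) True cd(2) disj(1-3)] by metis
    then show ?thesis using ab cd by (intro exI[of _ \<phi>]) auto
  next
    case False
    with sep have "d \<le> a" by simp
    moreover have "B \<inter> frontier B = {}" "A \<inter> frontier B = {}"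
      using frB disj by auto
    ultimately obtain \<phi> where "d \<le> \<phi>" "\<phi> \<le> a" "circle_point x r \<phi> \<in> frontier B"
      using frontier_between_arcs[OF cd(5) ab(5) cd(2) _ ab(2) disj(4)] by metis
    then show ?thesis using ab cd frB by (intro exI[of _ \<phi>]) auto
  qed
  then obtain \<phi> where \<phi>: "\<theta> + pi - \<epsilon> \<le> \<phi>" "\<phi> \<le> \<theta> + pi + \<epsilon>"
      "circle_point x r \<phi> \<in> frontier A"
    by auto
  show ?thesis
  proof (rule that[OF \<phi>(3)])
    show "dist x (circle_point x r \<phi>) = r"
      using r by (simp add: dist_center_circle_point)
    have "dist (circle_point x r \<phi>) (2 *\<^sub>R x - y) \<le> r * \<bar>\<phi> - (\<theta> + pi)\<bar>"
      using dist_circle_point_le[of r x \<phi> "\<theta> + pi"] r \<theta> by (simp add: circle_point_antipode)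
    also have "\<dots> \<le> r * \<epsilon>" using \<phi> r by (intro mult_left_mono) auto
    finally show "dist (circle_point x r \<phi>) (2 *\<^sub>R x - y) \<le> r * \<epsilon>" .
  qed
qed

text \<open>
  Both arcs are nonempty, so the connected circle meets \<open>A\<close> and its complement.  This supplies the
  first step of a chain.
\<close>

lemma frontier_meets_circle:
  assumes B: "B \<inter> A = {}"
    and r: "0 < r" and \<epsilon>: "\<epsilon> < pi"
    and eps: "carleson_eps A B x r \<le> \<epsilon>"
  obtains y where "y \<in> frontier A" "dist x y = r"
proof -
  note e = carleson_eps_leD[OF r eps]
  obtain a b where "pi - \<epsilon> \<le> b - a" "circle_point x r ` {a<..<b} \<subseteq> A"
    using largest_arc_length[OF r e(1)] by metis
  then have "circle_point x r ((a + b) / 2) \<in> A" using \<epsilon> by (auto simp: image_subset_iff)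
  moreover obtain c d where "pi - \<epsilon> \<le> d - c" "circle_point x r ` {c<..<d} \<subseteq> B"
    using largest_arc_length[OF r e(2)] by metis
  then have "circle_point x r ((c + d) / 2) \<in> B" using \<epsilon> by (auto simp: image_subset_iff)
  ultimately have "range (circle_point x r) \<inter> A \<noteq> {}" "range (circle_point x r) - A \<noteq> {}"
    using B by blast+
  moreover have "connected (range (circle_point x r))"
    by (intro connected_continuous_image continuous_intros connected_UNIV)
  ultimately obtain t where "circle_point x r t \<in> frontier A"
    using connected_Int_frontier by blast
  then show ?thesis
    using r by (intro that) (auto simp: dist_center_circle_point)
qed

section \<open>Almost straight chains\<close>

text \<open>
  Repeated reflection of the last but one point in the last point, with an error \<open>E\<close> each time, keeps
  the step length equal to \<open>t\<close>.  The \<open>k\<close>-th step vector differs from the first one by at most \<open>k E\<close>,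
  and summing these errors gives at most \<open>k\<^sup>2 E\<close> for the \<open>k\<close>-th point.
\<close>

lemma almost_straight_chain:
  fixes G :: "'a::real_normed_vector set"
  assumes reflect: "\<And>x y. x \<in> G \<Longrightarrow> y \<in> G \<Longrightarrow> dist x y = t \<Longrightarrow>
      \<exists>z\<in>G. dist x z = t \<and> dist z (2 *\<^sub>R x - y) \<le> E"
    and "x \<in> G" "y \<in> G" "dist x y = t" "0 \<le> E"
  shows "\<exists>p\<in>G. dist x p \<le> real k * t \<and> dist p (x + real k *\<^sub>R (y - x)) \<le> (real k)\<^sup>2 * E"
proof -
  have "\<exists>p\<in>G. \<exists>q\<in>G. dist p q = t \<and> dist x p \<le> real k * t \<and>
      norm ((q - p) - (y - x)) \<le> real k * E \<and>
      dist p (x + real k *\<^sub>R (y - x)) \<le> (real k)\<^sup>2 * E"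
  proof (induction k)
    case 0
    then show ?case using assms(2-4) by (intro bexI[of _ x] bexI[of _ y]) auto
  next
    case (Suc k)
    then obtain p q where pq: "p \<in> G" "q \<in> G" "dist p q = t" "dist x p \<le> real k * t"
        "norm ((q - p) - (y - x)) \<le> real k * E"
        "dist p (x + real k *\<^sub>R (y - x)) \<le> (real k)\<^sup>2 * E"
      by blast
    obtain z where z: "z \<in> G" "dist q z = t" "dist z (2 *\<^sub>R q - p) \<le> E"
      using reflect[of q p] pq by (auto simp: dist_commute)
    have "dist x q \<le> real (Suc k) * t"
      using dist_triangle[of x q p] pq by (simp add: algebra_simps)
    moreover have "norm ((z - q) - (y - x)) \<le> real (Suc k) * E"
    proof -
      have "(z - q) - (y - x) = (z - (2 *\<^sub>R q - p)) + ((q - p) - (y - x))"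
        by (simp add: algebra_simps scaleR_2)
      then have "norm ((z - q) - (y - x)) \<le> norm (z - (2 *\<^sub>R q - p)) + norm ((q - p) - (y - x))"
        by (metis norm_triangle_ineq)
      then show ?thesis using z(3) pq(5) by (simp add: dist_norm algebra_simps)
    qed
    moreover have "dist q (x + real (Suc k) *\<^sub>R (y - x)) \<le> (real (Suc k))\<^sup>2 * E"
    proof -
      have "q - (x + real (Suc k) *\<^sub>R (y - x))
          = (p - (x + real k *\<^sub>R (y - x))) + ((q - p) - (y - x))"
        by (simp add: algebra_simps)
      then have "dist q (x + real (Suc k) *\<^sub>R (y - x))
          \<le> dist p (x + real k *\<^sub>R (y - x)) + norm ((q - p) - (y - x))"
        unfolding dist_norm by (metis norm_triangle_ineq)
      also have "\<dots> \<le> ((real k)\<^sup>2 + real k) * E"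
        using pq by (simp add: algebra_simps)
      also have "\<dots> \<le> (real (Suc k))\<^sup>2 * E"
        using \<open>0 \<le> E\<close> by (intro mult_right_mono) (auto simp: power2_eq_square algebra_simps)
      finally show ?thesis .
    qed
    ultimately show ?case using pq z by blast
  qed
  then show ?thesis by blast
qed

text \<open>
  A point of the line at parameter \<open>\<tau>\<close> is within one step of the lattice point with parameter
  \<open>\<plusminus>k\<close>, where \<open>k = \<lfloor>|\<tau>|\<rfloor>\<close>, and a chain comes close to this lattice point.  Rounding towards zero
  makes \<open>k t < r\<close>, so that the chain has not left the ball.  For negative \<open>\<tau>\<close> the chain starts at an
  approximate reflection \<open>y'\<close> of \<open>y\<close>; the initial error \<open>E\<close> grows to \<open>k E\<close>, whence the factor 2.
\<close>

lemma line_near_chain: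
  fixes G :: "'a::real_normed_vector set"
  assumes reflect: "\<And>x y. x \<in> G \<Longrightarrow> y \<in> G \<Longrightarrow> dist x y = t \<Longrightarrow>
      \<exists>z\<in>G. dist x z = t \<and> dist z (2 *\<^sub>R x - y) \<le> E"
    and xy: "x \<in> G" "y \<in> G" "dist x y = t" and "0 \<le> E" "0 < t"
    and w: "w = x + \<tau> *\<^sub>R (y - x)" "dist x w < r"
  shows "\<exists>p\<in>G \<inter> ball x r. dist w p \<le> t + 2 * (r / t)\<^sup>2 * E"
proof -
  define k where "k = nat \<lfloor>\<bar>\<tau>\<bar>\<rfloor>"
  have k: "real k \<le> \<bar>\<tau>\<bar>" "\<bar>\<tau>\<bar> < real k + 1"
    unfolding k_def by linarith+
  have nyx: "norm (y - x) = t" using xy(3) by (simp add: dist_norm norm_minus_commute)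
  have "\<bar>\<tau>\<bar> * t < r"
    using w nyx by (simp add: dist_norm)
  then have kt: "real k * t < r"
    using k(1) \<open>0 < t\<close> by (meson le_less_trans mult_right_mono order_less_imp_le)
  have kr: "(real k)\<^sup>2 * E \<le> (r / t)\<^sup>2 * E"
    using kt \<open>0 < t\<close> \<open>0 \<le> E\<close> by (intro mult_right_mono power_mono) (auto simp: field_simps)
  define \<sigma> :: real where "\<sigma> = (if 0 \<le> \<tau> then 1 else - 1)"
  have \<sigma>: "\<bar>\<tau> - \<sigma> * real k\<bar> \<le> 1"
    using k by (auto simp: \<sigma>_def)
  have "dist w (x + (\<sigma> * real k) *\<^sub>R (y - x)) = \<bar>\<tau> - \<sigma> * real k\<bar> * t"
    using nyx unfolding w(1) by (simp add: dist_norm flip: scaleR_diff_left)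
  then have near: "dist w (x + (\<sigma> * real k) *\<^sub>R (y - x)) \<le> t"
    using \<sigma> \<open>0 < t\<close> mult_right_mono[of "\<bar>\<tau> - \<sigma> * real k\<bar>" 1 t] by simp
  have "\<exists>p\<in>G. dist x p \<le> real k * t \<and>
      dist p (x + (\<sigma> * real k) *\<^sub>R (y - x)) \<le> 2 * (real k)\<^sup>2 * E"
  proof (cases "0 \<le> \<tau>")
    case True
    then obtain p where p: "p \<in> G" "dist x p \<le> real k * t"
        "dist p (x + real k *\<^sub>R (y - x)) \<le> (real k)\<^sup>2 * E"
      using almost_straight_chain[OF reflect xy \<open>0 \<le> E\<close>] by metis
    moreover have "(real k)\<^sup>2 * E \<le> 2 * (real k)\<^sup>2 * E"
      using \<open>0 \<le> E\<close> by simp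
    ultimately have "dist p (x + real k *\<^sub>R (y - x)) \<le> 2 * (real k)\<^sup>2 * E"
      by linarith
    then show ?thesis
      using p True by (intro bexI[of _ p]) (auto simp: \<sigma>_def)
  next
    case False
    obtain y' where y': "y' \<in> G" "dist x y' = t" "dist y' (2 *\<^sub>R x - y) \<le> E"
      using reflect xy by metis
    then obtain p where p: "p \<in> G" "dist x p \<le> real k * t"
        "dist p (x + real k *\<^sub>R (y' - x)) \<le> (real k)\<^sup>2 * E"
      using almost_straight_chain[OF reflect xy(1) _ _ \<open>0 \<le> E\<close>] by metis
    have "dist (x + real k *\<^sub>R (y' - x)) (x + (\<sigma> * real k) *\<^sub>R (y - x))
        = real k * dist y' (2 *\<^sub>R x - y)"
    proof -
      have "(x + real k *\<^sub>R (y' - x)) - (x + (\<sigma> * real k) *\<^sub>R (y - x))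
          = real k *\<^sub>R (y' - (2 *\<^sub>R x - y))"
        using False by (simp add: \<sigma>_def algebra_simps scaleR_2)
      then show ?thesis by (simp add: dist_norm)
    qed
    also have "\<dots> \<le> (real k)\<^sup>2 * E"
    proof -
      have "real k \<le> (real k)\<^sup>2" by (cases k) (auto simp: power2_eq_square)
      then show ?thesis using y'(3) by (intro mult_mono) auto
    qed
    finally have "dist p (x + (\<sigma> * real k) *\<^sub>R (y - x)) \<le> 2 * (real k)\<^sup>2 * E"
      using p(3) dist_triangle[of p "x + (\<sigma> * real k) *\<^sub>R (y - x)" "x + real k *\<^sub>R (y' - x)"]
      by simp
    then show ?thesis using p by blast
  qed
  then obtain p where p: "p \<in> G" "dist x p \<le> real k * t"
      "dist p (x + (\<sigma> * real k) *\<^sub>R (y - x)) \<le> 2 * (real k)\<^sup>2 * E"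
    by blast
  have "dist w p \<le> t + 2 * (r / t)\<^sup>2 * E"
    using near p(3) kr dist_triangle2[of w p "x + (\<sigma> * real k) *\<^sub>R (y - x)"] by linarith
  then show ?thesis using p kt by (intro bexI[of _ p]) auto
qed

section \<open>Flatness of the boundary\<close>

theorem lemma1:
  fixes \<Omega>p \<Omega>m \<Gamma> :: "(real ^ 2) set" and \<alpha> C0 r0 :: real
  assumes "jordan_domain \<Omega>p"
    and "\<Omega>m = UNIV - closure \<Omega>p"
    and "\<Gamma> = frontier \<Omega>p"
    and "0 < \<alpha>" and "\<alpha> < 1" and "0 < C0"
    and "0 < r0"
    and "\<forall>x\<in>\<Gamma>. \<forall>r. 0 < r \<and> r \<le> r0 \<longrightarrow> carleson_eps \<Omega>p \<Omega>m x r \<le> C0 * r powr \<alpha>"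
  shows "\<exists>\<rho>0 C. 0 < \<rho>0 \<and> \<rho>0 \<le> r0 \<and> 0 < C \<and>
           (\<forall>x0\<in>\<Gamma>. \<forall>r. 0 < r \<and> r \<le> \<rho>0 \<longrightarrow>
              (\<exists>L. line_through x0 L \<and>
                 (SUP x\<in>L \<inter> ball x0 r. infdist x (\<Gamma> \<inter> ball x0 r)) < C * r powr (\<alpha> / 2 + 1)))"
proof -
  have A: "open \<Omega>p" using assms(1) by (simp add: jordan_domain_def)
  \<comment> \<open>\<open>\<rho>0 \<le> 1\<close> makes \<open>t \<le> r\<close> below; the last entry gives
    \<open>C0 t\<^sup>\<alpha> \<le> 1 < \<pi>\<close>, so that the arcs are nonempty\<close>
  define \<rho>0 where "\<rho>0 = min (min r0 1) ((1 / C0) powr (1 / \<alpha>))"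
  \<comment> \<open>one more than the factor \<open>1 + 2 C0\<close> in the estimate, to make the inequality strict\<close>
  define C where "C = 2 + 2 * C0"
  have \<rho>0: "0 < \<rho>0" "\<rho>0 \<le> r0" "\<rho>0 \<le> 1" "\<rho>0 \<le> (1 / C0) powr (1 / \<alpha>)"
    using assms(6,7) by (auto simp: \<rho>0_def)
  have eps: "carleson_eps \<Omega>p \<Omega>m x t \<le> C0 * t powr \<alpha> \<and> C0 * t powr \<alpha> < pi"
    if "x \<in> \<Gamma>" "0 < t" "t \<le> \<rho>0" for x t
  proof -
    have "t powr \<alpha> \<le> ((1 / C0) powr (1 / \<alpha>)) powr \<alpha>"
      using that \<rho>0 assms(4) by (intro powr_mono2) auto
    also have "\<dots> = 1 / C0" using assms(4,6) by (simp add: powr_powr)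
    finally have "C0 * t powr \<alpha> \<le> 1" using assms(6) by (simp add: field_simps)
    moreover have "t \<le> r0" using that(3) \<rho>0(2) by linarith
    ultimately show ?thesis using assms(8) that pi_gt3 by auto
  qed
  have "\<exists>L. line_through x0 L \<and>
      (SUP x\<in>L \<inter> ball x0 r. infdist x (\<Gamma> \<inter> ball x0 r)) < C * r powr (\<alpha> / 2 + 1)"
    if x0: "x0 \<in> \<Gamma>" and r: "0 < r" "r \<le> \<rho>0" for x0 r
  proof -
    define t where "t = r powr (\<alpha> / 2 + 1)"
    define E where "E = t * (C0 * t powr \<alpha>)"
    have "t \<le> r powr 1"
      unfolding t_def using r \<rho>0 assms(4) by (intro powr_mono') auto
    then have t: "0 < t" "t \<le> \<rho>0" using r by (auto simp: t_def)
    have E: "0 \<le> E" using t assms(6) by (simp add: E_def)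
    have reflect: "\<exists>z\<in>\<Gamma>. dist x z = t \<and> dist z (2 *\<^sub>R x - y) \<le> E"
      if "x \<in> \<Gamma>" "y \<in> \<Gamma>" "dist x y = t" for x y
    proof -
      have "C0 * t powr \<alpha> < pi" "carleson_eps \<Omega>p \<Omega>m x t \<le> C0 * t powr \<alpha>"
        using eps[OF that(1) t] by simp_all
      from antipode_near_frontier[OF A assms(2) t(1) this that(2)[unfolded assms(3)] that(3)]
      show ?thesis unfolding assms(3) E_def by blast
    qed
    have "\<Omega>m \<inter> \<Omega>p = {}" using closure_subset assms(2) by blast
    moreover have "C0 * t powr \<alpha> < pi" "carleson_eps \<Omega>p \<Omega>m x0 t \<le> C0 * t powr \<alpha>"
      using eps[OF x0 t] by simp_all
    ultimately obtain y where y: "y \<in> \<Gamma>" "dist x0 y = t"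
      using frontier_meets_circle[OF _ t(1)] unfolding assms(3) by blast
    define L where "L = affine hull {x0, y}"
    have "x0 \<noteq> y" using y t by auto
    then have "line_through x0 L"
      by (simp add: line_through_def L_def aff_dim_2 hull_inc)
    moreover have "(SUP x\<in>L \<inter> ball x0 r. infdist x (\<Gamma> \<inter> ball x0 r)) < C * t"
    proof -
      have err: "t + 2 * (r / t)\<^sup>2 * E \<le> (1 + 2 * C0) * t"
      proof -
        have "(r / t)\<^sup>2 * t powr \<alpha> = r powr (\<alpha>\<^sup>2 / 2)"
        proof -
          have "r / t = r powr (- \<alpha> / 2)"
            using r powr_diff[of r 1 "\<alpha> / 2 + 1"] by (simp add: t_def)
          then have "(r / t)\<^sup>2 = r powr (- \<alpha>)"
            by (simp add: power2_eq_square flip: powr_add)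
          then show ?thesis
            by (simp add: t_def powr_powr power2_eq_square algebra_simps flip: powr_add)
        qed
        also have "\<dots> \<le> 1"
          using r \<rho>0 by (intro powr_le1) auto
        finally have "2 * C0 * t * ((r / t)\<^sup>2 * t powr \<alpha>) \<le> 2 * C0 * t * 1"
          using t assms(6) by (intro mult_left_mono) auto
        then show ?thesis by (simp add: E_def algebra_simps)
      qed
      have "infdist w (\<Gamma> \<inter> ball x0 r) \<le> (1 + 2 * C0) * t" if w: "w \<in> L \<inter> ball x0 r" for w
      proof -
        obtain u v where "u + v = 1" "w = u *\<^sub>R x0 + v *\<^sub>R y"
          using w by (auto simp: L_def affine_hull_2)
        then have "w = (1 - v) *\<^sub>R x0 + v *\<^sub>R y"
          by (metis add_diff_cancel_right')
        then have "w = x0 + v *\<^sub>R (y - x0)"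
          by (simp add: scaleR_diff_left scaleR_diff_right)
        moreover have "dist x0 w < r" using w by simp
        ultimately obtain p where "p \<in> \<Gamma> \<inter> ball x0 r" "dist w p \<le> t + 2 * (r / t)\<^sup>2 * E"
          using line_near_chain[OF reflect x0 y E t(1)] by metis
        then show ?thesis using infdist_le2 err by (meson order_trans)
      qed
      moreover have "x0 \<in> L \<inter> ball x0 r" using r by (simp add: L_def hull_inc)
      ultimately have "(SUP x\<in>L \<inter> ball x0 r. infdist x (\<Gamma> \<inter> ball x0 r)) \<le> (1 + 2 * C0) * t"
        by (intro cSUP_least) auto
      also have "\<dots> < C * t" using t by (simp add: C_def)
      finally show ?thesis .
    qed
    ultimately show ?thesis unfolding t_def by blast
  qed
  then show ?thesis
    using \<rho>0 assms(6) by (intro exI[of _ \<rho>0] exI[of _ C]) (auto simp: C_def)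
qed

end
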